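(* Let $m\ge 1$ be an integer, let $u_-=u_0<u_1<\cdots<u_m<u_{m+1}=u_+$ be real numbers, let $a_i>0$, $k_i>0$ for $i=0,\dots,m$ and $d_i\ge 0$ for $i=1,\dots,m$. Let $\Omega=\{\bar\xi=(\xi_1,\ldots,\xi_m)\in\mathbb{R}^m : \xi_1<\cdots<\xi_m\}$. Then the function $E:\Omega\to\mathbb{R}$, $$E(\bar\xi)=-\sum_{i=0}^m k_i(u_{i+1}-u_i)\ln\bigl(F(\xi_{i+1}/a_i)-F(\xi_i/a_i)\bigr)+\sum_{i=1}^m \frac{d_i\xi_i^2}{4},$$ where $\xi_0=-\infty$, $\xi_{m+1}=+\infty$, is strictly convex on the open convex set $\Omega$.
   Context: $F(\xi)=\frac{1}{2\sqrt{\pi}}\int_{-\infty}^{\xi}e^{-s^2/4}\,ds$ for $\xi\in\mathbb{R}$, with the conventions $F(-\infty)=0$, $F(+\infty)=1$. *)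

theory Defs
  imports "HOL-Analysis.Analysis"
begin

definition F :: "ereal \<Rightarrow> real" where
  "F \<xi> = (case \<xi> of
      ereal x \<Rightarrow> 1 / (2 * sqrt pi) * (LINT s:{..x}|lborel. exp (- (s^2) / 4))
    | PInfty \<Rightarrow> 1
    | MInfty \<Rightarrow> 0)"

definition strictly_convex_on :: "'a::real_vector set \<Rightarrow> ('a \<Rightarrow> real) \<Rightarrow> bool" where
  "strictly_convex_on S f \<longleftrightarrow> convex S \<and>
    (\<forall>x\<in>S. \<forall>y\<in>S. \<forall>u>0. \<forall>v>0. x \<noteq> y \<longrightarrow> u + v = 1 \<longrightarrow>
      f (u *\<^sub>R x + v *\<^sub>R y) < u * f x + v * f y)"

text \<open>
  A point of \<open>\<real>\<^sup>m\<close> is a vector \<open>x :: real ^ 'n\<close> together with an enumeration \<open>e\<close> of the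
  index type, a bijection from \<open>{1..m}\<close> onto \<open>UNIV :: 'n set\<close>; its \<open>i\<close>-th coordinate is
  \<open>x $ e i\<close>. The function \<open>ext_coord\<close> adds the endpoints at \<open>0\<close> and \<open>m + 1\<close>.
\<close>

definition ext_coord :: "nat \<Rightarrow> (nat \<Rightarrow> 'n) \<Rightarrow> real ^ 'n \<Rightarrow> nat \<Rightarrow> ereal" where
  "ext_coord m e x i =
    (if i = 0 then - \<infinity> else if i \<le> m then ereal (x $ e i) else \<infinity>)"

definition \<Omega> :: "nat \<Rightarrow> (nat \<Rightarrow> 'n) \<Rightarrow> (real ^ 'n) set" where
  "\<Omega> m e = {x. \<forall>i\<in>{1..<m}. x $ e i < x $ e (i + 1)}"

definition E ::
  "nat \<Rightarrow> (nat \<Rightarrow> 'n) \<Rightarrow> (nat \<Rightarrow> real) \<Rightarrow> (nat \<Rightarrow> real) \<Rightarrow> (nat \<Rightarrow> real) \<Rightarrow> (nat \<Rightarrow> real)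
    \<Rightarrow> real ^ 'n \<Rightarrow> real" where
  "E m e u a k d x =
    - (\<Sum>i=0..m. k i * (u (i + 1) - u i) *
        ln (F (ext_coord m e x (i + 1) / ereal (a i)) - F (ext_coord m e x i / ereal (a i))))
    + (\<Sum>i=1..m. d i * (x $ e i)^2 / 4)"

end

theory Submission
  imports Defs "HOL-Probability.Distributions" "HOL-Probability.Distribution_Functions"
begin

text \<open>
  \<open>F\<close> is the distribution function of the normal law \<open>N(0, 2)\<close>, with density \<open>\<phi>\<close> satisfying
  \<open>\<phi>' x = - (x / 2) * \<phi> x\<close>. The logarithm of the mass \<open>F y - F x\<close> is strictly concave in
  \<open>(x, y)\<close>, also when one endpoint is infinite: along a line, \<open>P = F y - F x\<close> satisfies
  \<open>P P'' < P'\<^sup>2\<close>, which is the positivity of a quadratic form and reduces to the Mills-type bound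
  \<open>x / 2 * (F y - F x) \<le> \<phi> x - \<phi> y\<close>. The quadratic terms of \<open>E\<close> may vanish, so strictness
  comes from the logarithms: if two points differ in coordinate \<open>i\<close>, the \<open>i\<close>-th one is strict.
\<close>

section \<open>The Gaussian density and its distribution function\<close>

definition gauss :: "real \<Rightarrow> real" where
  "gauss x = exp (- (x^2) / 4) / (2 * sqrt pi)"

text \<open>A version of \<open>F\<close> on the reals, to which derivative and limit rules apply;
  the infinite arguments are treated separately in \<open>gap_eq\<close>.\<close>

definition Gauss :: "real \<Rightarrow> real" where
  "Gauss x = F (ereal x)"

lemma gauss_pos: "gauss x > 0"
  by (simp add: gauss_def)

lemma gauss_uminus: "gauss (- x) = gauss x"
  by (simp add: gauss_def)

lemma gauss_eq_normal_density: "gauss = normal_density 0 (sqrt 2)"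
  by (simp add: fun_eq_iff gauss_def normal_density_def real_sqrt_mult)

lemma Gauss_eq_LINT: "Gauss x = (LINT s:{..x}|lborel. gauss s)"
  by (simp add: Gauss_def F_def gauss_def set_lebesgue_integral_def)

text \<open>Once \<open>Gauss\<close> is a cumulative distribution function, its limits 0 and 1
  follow from general facts about probability measures.\<close>

lemma Gauss_eq_cdf: "Gauss = cdf (density lborel gauss)"
proof
  fix x
  have "emeasure (density lborel gauss) {..x} = ennreal (LINT s:{..x}|lborel. gauss s)"
    unfolding gauss_eq_normal_density set_lebesgue_integral_def
    by (subst emeasure_density, simp, simp, subst nn_integral_eq_integral[symmetric])
       (auto intro!: integrable_mult_indicator nn_integral_cong split: split_indicator
             simp del: real_scaleR_def)
  moreover have "(LINT s:{..x}|lborel. gauss s) \<ge> 0"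
    unfolding set_lebesgue_integral_def
    by (intro integral_nonneg_AE) (simp add: gauss_pos less_imp_le)
  ultimately show "Gauss x = cdf (density lborel gauss) x"
    by (simp add: Gauss_eq_LINT cdf_def measure_def)
qed

lemma real_distribution_gauss: "real_distribution (density lborel gauss)"
  unfolding gauss_eq_normal_density real_distribution_def real_distribution_axioms_def
  by (simp add: prob_space_normal_density)

lemma tendsto_Gauss_at_top: "(Gauss \<longlongrightarrow> 1) at_top"
  unfolding Gauss_eq_cdf by (rule real_distribution.cdf_lim_at_top_prob[OF real_distribution_gauss])

lemma tendsto_Gauss_at_bot: "(Gauss \<longlongrightarrow> 0) at_bot"
  unfolding Gauss_eq_cdf
  by (rule finite_borel_measure.cdf_lim_at_bot[OF real_distribution.finite_borel_measure_M[OF real_distribution_gauss]])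

lemma continuous_on_gauss: "continuous_on A gauss"
  unfolding gauss_def[abs_def] by (intro continuous_intros) auto

text \<open>On a compact interval the fundamental theorem of calculus applies; this is the route to
  the derivative of \<open>Gauss\<close>.\<close>

lemma Gauss_diff_eq_integral:
  assumes "x \<le> y"
  shows "Gauss y - Gauss x = integral {x..y} gauss"
proof -
  have int: "set_integrable lborel A gauss" if "A \<in> sets borel" for A
    unfolding set_integrable_def gauss_eq_normal_density using that
    by (intro integrable_mult_indicator) auto
  have "(LINT s:{..x} \<union> {x<..y}|lborel. gauss s)
      = (LINT s:{..x}|lborel. gauss s) + (LINT s:{x<..y}|lborel. gauss s)"
    by (intro set_integral_Un int) auto
  moreover have "{..x} \<union> {x<..y} = {..y}"
    using assms by auto
  moreover have "(LINT s:{x<..y}|lborel. gauss s) = (LINT s:{x..y}|lborel. gauss s)"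
    unfolding set_lebesgue_integral_def
    by (rule integral_cong_AE)
       (use AE_lborel_singleton[of x] in \<open>auto simp: gauss_eq_normal_density split: split_indicator\<close>)
  ultimately show ?thesis
    by (simp add: Gauss_eq_LINT set_borel_integral_eq_integral(2)[OF int])
qed

lemma DERIV_Gauss: "(Gauss has_real_derivative gauss x) (at x)"
proof -
  \<comment> \<open>Starting the interval at \<open>x - 1\<close> puts \<open>x\<close> in its
    interior, so the derivative within the interval is a full one.\<close>
  have "((\<lambda>t. integral {x - 1..t} gauss) has_real_derivative gauss x) (at x within {x - 1..x + 1})"
    by (intro integral_has_real_derivative continuous_on_gauss) auto
  hence "((\<lambda>t. integral {x - 1..t} gauss) has_real_derivative gauss x) (at x)"
    by (subst (asm) at_within_interior) auto
  hence "((\<lambda>t. Gauss (x - 1) + integral {x - 1..t} gauss) has_real_derivative gauss x) (at x)"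
    by (auto intro!: derivative_eq_intros)
  thus ?thesis
  proof (rule DERIV_cong_ev[THEN iffD1, rotated -1])
    show "\<forall>\<^sub>F t in nhds x. Gauss (x - 1) + integral {x - 1..t} gauss = Gauss t"
      using eventually_nhds_in_open[of "{x - 1<..}" x]
      by (auto elim!: eventually_mono simp flip: Gauss_diff_eq_integral)
  qed auto
qed

lemma DERIV_gauss: "(gauss has_real_derivative - (x / 2) * gauss x) (at x)"
  unfolding gauss_def[abs_def] by (auto intro!: derivative_eq_intros simp: field_simps)

lemmas DERIV_Gauss' [derivative_intros] = DERIV_chain2[OF DERIV_Gauss]
lemmas DERIV_gauss' [derivative_intros] = DERIV_chain2[OF DERIV_gauss]

lemma Gauss_strict_mono: "x < y \<Longrightarrow> Gauss x < Gauss y"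
  using DERIV_pos_imp_increasing DERIV_Gauss gauss_pos by blast

lemma Gauss_pos: "0 < Gauss x"
  using DERIV_pos_imp_increasing_at_bot[OF _ tendsto_Gauss_at_bot] DERIV_Gauss gauss_pos by blast

text \<open>As the density is even, \<open>Gauss t + Gauss (- t)\<close> has derivative zero; its
  limit at infinity identifies the constant as 1.\<close>

lemma Gauss_uminus: "Gauss (- x) = 1 - Gauss x"
proof -
  define c where "c = Gauss 0 + Gauss (- 0)"
  have const: "Gauss t + Gauss (- t) = c" for t
    unfolding c_def
    by (rule DERIV_isconst_all[where f = "\<lambda>t. Gauss t + Gauss (- t)"])
       (auto intro!: derivative_eq_intros simp: gauss_uminus)
  have "((\<lambda>t. Gauss t + Gauss (- t)) \<longlongrightarrow> 1 + 0) at_top"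
    by (intro tendsto_add tendsto_Gauss_at_top
        filterlim_compose[OF tendsto_Gauss_at_bot filterlim_uminus_at_bot_at_top])
  hence "c = 1"
    unfolding const by (simp add: tendsto_const_iff)
  with const[of x] show ?thesis by simp
qed

lemma Gauss_less_1: "Gauss x < 1"
  using Gauss_pos[of "- x"] by (simp add: Gauss_uminus)

section \<open>Mills-type bounds and the quadratic form of a gap\<close>

lemma gauss_diff_ge:
  assumes "x \<le> y"
  shows "x / 2 * (Gauss y - Gauss x) \<le> gauss x - gauss y"
proof -
  \<comment> \<open>The density satisfies gauss' s = - (s / 2) * gauss s, so
    \<open>gauss x - gauss y\<close> is the integral of s / 2 * gauss s from \<open>x\<close> to
    \<open>y\<close>, where s is at least \<open>x\<close>. \<open>?h\<close> is the resulting
    excess as a function of the right end.\<close>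
  let ?h = "\<lambda>t. gauss x - gauss t - x / 2 * (Gauss t - Gauss x)"
  have "?h x \<le> ?h y"
    using assms
  proof (rule DERIV_nonneg_imp_nondecreasing)
    fix t assume "x \<le> t"
    hence "(t - x) / 2 * gauss t \<ge> 0"
      using gauss_pos[of t] by simp
    moreover have "DERIV ?h t :> (t - x) / 2 * gauss t"
      by (auto intro!: derivative_eq_intros simp: field_simps)
    ultimately show "\<exists>d. DERIV ?h t :> d \<and> d \<ge> 0" by blast
  qed
  thus ?thesis by simp
qed

lemma gauss_tail_ge: "x / 2 * (1 - Gauss x) \<le> gauss x"
proof (rule tendsto_upperbound)
  show "((\<lambda>y. x / 2 * (Gauss y - Gauss x)) \<longlongrightarrow> x / 2 * (1 - Gauss x)) at_top"
    by (intro tendsto_intros tendsto_Gauss_at_top)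
  show "\<forall>\<^sub>F y in at_top. x / 2 * (Gauss y - Gauss x) \<le> gauss x"
    using eventually_ge_at_top[of x]
  proof eventually_elim
    case (elim y)
    thus ?case using gauss_diff_ge[OF elim] gauss_pos[of y] by linarith
  qed
qed auto

text \<open>The passage to the limit loses strictness. It is regained by cutting the tail at
  \<open>x + 1\<close>: beyond the cut the factor is \<open>(x + 1) / 2\<close> instead of
  \<open>x / 2\<close>, and the mass there is positive.\<close>

lemma gauss_tail_gt: "x / 2 * (1 - Gauss x) < gauss x"
proof -
  have "x / 2 * (Gauss (x + 1) - Gauss x) \<le> gauss x - gauss (x + 1)"
    by (rule gauss_diff_ge) simp
  moreover have "(x + 1) / 2 * (1 - Gauss (x + 1)) \<le> gauss (x + 1)"
    by (rule gauss_tail_ge)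
  ultimately show ?thesis
    using Gauss_less_1[of "x + 1"] by (simp add: field_simps)
qed

text \<open>The determinant of the quadratic form in \<open>gauss_gap_form\<close> is a positive multiple of the
  left-hand side; as a function of \<open>y\<close> it vanishes at \<open>x\<close> and has derivative
  \<open>gauss x - x / 2 * (Gauss y - Gauss x)\<close>.\<close>

lemma gauss_gap_det_pos:
  assumes "x < y"
  shows "0 < y * gauss x - x * gauss y - x * y / 2 * (Gauss y - Gauss x)"
proof -
  let ?h = "\<lambda>t. t * gauss x - x * gauss t - x * t / 2 * (Gauss t - Gauss x)"
  have "?h x < ?h y"
    using assms
  proof (rule DERIV_pos_imp_increasing)
    fix t assume "x \<le> t"
    hence "gauss x - x / 2 * (Gauss t - Gauss x) > 0"
      using gauss_diff_ge[of x t] gauss_pos[of t] by linarith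
    moreover have "DERIV ?h t :> gauss x - x / 2 * (Gauss t - Gauss x)"
      by (auto intro!: derivative_eq_intros simp: field_simps)
    ultimately show "\<exists>d. DERIV ?h t :> d \<and> d > 0" by blast
  qed
  thus ?thesis by simp
qed

lemma binary_quadratic_form_pos:
  fixes A B C h l :: real
  assumes "A > 0" "A * C > B\<^sup>2" "h \<noteq> 0 \<or> l \<noteq> 0"
  shows "A * h\<^sup>2 + 2 * B * h * l + C * l\<^sup>2 > 0"
proof -
  have eq: "A * (A * h\<^sup>2 + 2 * B * h * l + C * l\<^sup>2) = (A * h + B * l)\<^sup>2 + (A * C - B\<^sup>2) * l\<^sup>2"
    by (simp add: power2_eq_square algebra_simps)
  have "\<dots> > 0"
  proof (cases "l = 0")
    case True
    thus ?thesis using assms by simp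
  next
    case False
    thus ?thesis using assms by (intro add_nonneg_pos mult_pos_pos) auto
  qed
  thus ?thesis
    using assms(1) unfolding eq[symmetric] by (simp add: zero_less_mult_iff)
qed

text \<open>This is P P'' < P'^2 for P = Gauss y - Gauss x when \<open>x\<close> and
  \<open>y\<close> move with constant speeds \<open>h\<close> and \<open>l\<close>.\<close>

lemma gauss_gap_form:
  assumes "x < y" and "h \<noteq> 0 \<or> l \<noteq> 0"
  shows "(Gauss y - Gauss x) * (h\<^sup>2 * (x / 2 * gauss x) - l\<^sup>2 * (y / 2 * gauss y))
    < (l * gauss y - h * gauss x)\<^sup>2"
proof -
  define I where "I = Gauss y - Gauss x"
  \<comment> \<open>P'^2 - P P'' is a quadratic form in \<open>h\<close> and \<open>l\<close> with
    coefficients \<open>A\<close>, \<open>2 * B\<close> and \<open>C\<close>.\<close>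
  define A where "A = gauss x * (gauss x - x / 2 * I)"
  define B where "B = - (gauss x * gauss y)"
  define C where "C = gauss y * (gauss y + y / 2 * I)"
  have I: "I > 0" using Gauss_strict_mono[OF assms(1)] by (simp add: I_def)
  have "gauss x - x / 2 * I > 0"
    using gauss_diff_ge[of x y] gauss_pos[of y] assms(1) unfolding I_def by linarith
  hence A: "A > 0" by (simp add: A_def gauss_pos)
  have "A * C - B\<^sup>2
      = gauss x * gauss y * I / 2 * (y * gauss x - x * gauss y - x * y / 2 * I)"
    by (simp add: A_def B_def C_def power2_eq_square field_simps)
  also have "\<dots> > 0"
    using gauss_gap_det_pos[OF assms(1)] I by (simp add: gauss_pos I_def)
  finally have "A * C > B\<^sup>2" by simp
  from binary_quadratic_form_pos[OF A this assms(2)] show ?thesis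
    unfolding A_def B_def C_def I_def[symmetric] by (simp add: power2_eq_square algebra_simps)
qed

section \<open>Strict concavity of logarithms of Gaussian masses along segments\<close>

lemma strict_concave_01:
  fixes f f' f'' :: "real \<Rightarrow> real"
  assumes f: "\<And>t. 0 \<le> t \<Longrightarrow> t \<le> 1 \<Longrightarrow> DERIV f t :> f' t"
    and f': "\<And>t. 0 \<le> t \<Longrightarrow> t \<le> 1 \<Longrightarrow> DERIV f' t :> f'' t"
    and neg: "\<And>t. 0 \<le> t \<Longrightarrow> t \<le> 1 \<Longrightarrow> f'' t < 0"
    and v: "0 < v" "v < 1"
  shows "(1 - v) * f 0 + v * f 1 < f v"
proof -
  obtain p where p: "0 < p" "p < v" "f v - f 0 = (v - 0) * f' p"
    using MVT2[of 0 v f f'] f v by auto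
  obtain q where q: "v < q" "q < 1" "f 1 - f v = (1 - v) * f' q"
    using MVT2[of v 1 f f'] f v by auto
  have "f' q < f' p"
  proof (rule DERIV_neg_imp_decreasing[where f = f' and a = p and b = q])
    show "\<exists>d. DERIV f' t :> d \<and> d < 0" if "p \<le> t" "t \<le> q" for t
      using that p q v f'[of t] neg[of t] by auto
  qed (use p q in auto)
  \<comment> \<open>The two mean value slopes, left and right of \<open>v\<close>, differ by exactly
    the concavity defect at \<open>v\<close> divided by \<open>v * (1 - v)\<close>.\<close>
  hence "0 < v * (1 - v) * (f' p - f' q)"
    using v by simp
  also have "\<dots> = (1 - v) * (f v - f 0) - v * (f 1 - f v)"
    unfolding p(3) q(3) by (simp add: algebra_simps)
  also have "\<dots> = f v - ((1 - v) * f 0 + v * f 1)"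
    by (simp add: algebra_simps)
  finally show ?thesis by simp
qed

text \<open>The second derivative of ln P is (P P'' - P'^2) / P^2, negative by
  \<open>less\<close>.\<close>

lemma strict_concave_ln_01:
  fixes P P' P'' :: "real \<Rightarrow> real"
  assumes P: "\<And>t. 0 \<le> t \<Longrightarrow> t \<le> 1 \<Longrightarrow> P t > 0"
    and P': "\<And>t. DERIV P t :> P' t"
    and P'': "\<And>t. DERIV P' t :> P'' t"
    and less: "\<And>t. 0 \<le> t \<Longrightarrow> t \<le> 1 \<Longrightarrow> P t * P'' t < (P' t)\<^sup>2"
    and v: "0 < v" "v < 1"
  shows "(1 - v) * ln (P 0) + v * ln (P 1) < ln (P v)"
proof (rule strict_concave_01[where f = "\<lambda>t. ln (P t)" and f' = "\<lambda>t. P' t / P t"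
      and f'' = "\<lambda>t. (P'' t * P t - P' t * P' t) / (P t * P t)"])
  fix t :: real assume t: "0 \<le> t" "t \<le> 1"
  show "DERIV (\<lambda>t. ln (P t)) t :> P' t / P t"
    using P[OF t] by (auto intro!: derivative_eq_intros P')
  show "DERIV (\<lambda>t. P' t / P t) t :> (P'' t * P t - P' t * P' t) / (P t * P t)"
    using P[OF t] by (auto intro!: derivative_eq_intros P' P'')
  show "(P'' t * P t - P' t * P' t) / (P t * P t) < 0"
    using P[OF t] less[OF t] by (simp add: divide_less_0_iff power2_eq_square mult.commute)
qed (use v in auto)

text \<open>A weight may be zero because the ordering is also wanted at both ends of a
  segment.\<close>

lemma convex_combination_less:
  fixes a b c d :: real
  assumes "a < b" "c < d" "0 \<le> u" "0 \<le> v" "u + v = 1"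
  shows "u * a + v * c < u * b + v * d"
proof (cases "u = 0")
  case True
  thus ?thesis using assms by simp
next
  case False
  thus ?thesis using assms by (intro add_less_le_mono mult_strict_left_mono mult_left_mono) auto
qed

lemma strict_concave_ln_Gauss_gap:
  assumes "x < y" "x' < y'" and ne: "x \<noteq> x' \<or> y \<noteq> y'" and v: "0 < v" "v < 1"
  shows "(1 - v) * ln (Gauss y - Gauss x) + v * ln (Gauss y' - Gauss x')
    < ln (Gauss ((1 - v) * y + v * y') - Gauss ((1 - v) * x + v * x'))"
proof -
  define X where "X t = (1 - t) * x + t * x'" for t
  define Y where "Y t = (1 - t) * y + t * y'" for t
  define h where "h = x' - x"
  define l where "l = y' - y"
  have less: "X t < Y t" if "0 \<le> t" "t \<le> 1" for t
    unfolding X_def Y_def using that assms by (intro convex_combination_less) auto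
  have [derivative_intros]: "(X has_real_derivative h) (at t)" "(Y has_real_derivative l) (at t)" for t
    unfolding X_def[abs_def] Y_def[abs_def] h_def l_def
    by (auto intro!: derivative_eq_intros)
  have "(1 - v) * ln (Gauss (Y 0) - Gauss (X 0)) + v * ln (Gauss (Y 1) - Gauss (X 1))
    < ln (Gauss (Y v) - Gauss (X v))"
  proof (rule strict_concave_ln_01[where P' = "\<lambda>t. l * gauss (Y t) - h * gauss (X t)"
        and P'' = "\<lambda>t. h\<^sup>2 * (X t / 2 * gauss (X t)) - l\<^sup>2 * (Y t / 2 * gauss (Y t))"])
    fix t :: real
    show "DERIV (\<lambda>t. Gauss (Y t) - Gauss (X t)) t :> l * gauss (Y t) - h * gauss (X t)"
      by (auto intro!: derivative_eq_intros)
    show "DERIV (\<lambda>t. l * gauss (Y t) - h * gauss (X t)) t :>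
        h\<^sup>2 * (X t / 2 * gauss (X t)) - l\<^sup>2 * (Y t / 2 * gauss (Y t))"
      by (auto intro!: derivative_eq_intros simp: power2_eq_square algebra_simps)
    assume t: "0 \<le> t" "t \<le> 1"
    show "Gauss (Y t) - Gauss (X t) > 0"
      using Gauss_strict_mono[OF less[OF t]] by simp
    show "(Gauss (Y t) - Gauss (X t)) *
        (h\<^sup>2 * (X t / 2 * gauss (X t)) - l\<^sup>2 * (Y t / 2 * gauss (Y t)))
        < (l * gauss (Y t) - h * gauss (X t))\<^sup>2"
      using ne by (intro gauss_gap_form less t) (auto simp: h_def l_def)
  qed (use v in auto)
  thus ?thesis by (simp add: X_def Y_def)
qed

lemma strict_concave_ln_Gauss_upper_tail:
  assumes ne: "x \<noteq> x'" and v: "0 < v" "v < 1"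
  shows "(1 - v) * ln (1 - Gauss x) + v * ln (1 - Gauss x') < ln (1 - Gauss ((1 - v) * x + v * x'))"
proof -
  define X where "X t = (1 - t) * x + t * x'" for t
  define h where "h = x' - x"
  have [derivative_intros]: "(X has_real_derivative h) (at t)" for t
    unfolding X_def[abs_def] h_def by (auto intro!: derivative_eq_intros)
  have "(1 - v) * ln (1 - Gauss (X 0)) + v * ln (1 - Gauss (X 1)) < ln (1 - Gauss (X v))"
  proof (rule strict_concave_ln_01[where P' = "\<lambda>t. - (h * gauss (X t))"
        and P'' = "\<lambda>t. h\<^sup>2 * (X t / 2 * gauss (X t))"])
    fix t :: real
    show "DERIV (\<lambda>t. 1 - Gauss (X t)) t :> - (h * gauss (X t))"
      by (auto intro!: derivative_eq_intros)
    show "DERIV (\<lambda>t. - (h * gauss (X t))) t :> h\<^sup>2 * (X t / 2 * gauss (X t))"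
      by (auto intro!: derivative_eq_intros simp: power2_eq_square algebra_simps)
    show "1 - Gauss (X t) > 0"
      using Gauss_less_1 by simp
    \<comment> \<open>This product is P'^2 - P P'' for the tail mass P; its last factor is positive
      by the strict tail bound.\<close>
    have "0 < h\<^sup>2 * gauss (X t) * (gauss (X t) - X t / 2 * (1 - Gauss (X t)))"
      using ne gauss_tail_gt[of "X t"] by (intro mult_pos_pos) (auto simp: gauss_pos h_def)
    thus "(1 - Gauss (X t)) * (h\<^sup>2 * (X t / 2 * gauss (X t))) < (- (h * gauss (X t)))\<^sup>2"
      by (simp add: power2_eq_square algebra_simps)
  qed (use v in auto)
  thus ?thesis by (simp add: X_def)
qed

text \<open>Reflection at the origin turns lower tails into upper tails and respects convex
  combinations.\<close>

lemma strict_concave_ln_Gauss_lower_tail: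
  assumes "x \<noteq> x'" and "0 < v" "v < 1"
  shows "(1 - v) * ln (Gauss x) + v * ln (Gauss x') < ln (Gauss ((1 - v) * x + v * x'))"
proof -
  have "- ((1 - v) * x + v * x') = (1 - v) * (- x) + v * (- x')"
    by (simp add: algebra_simps)
  thus ?thesis
    using strict_concave_ln_Gauss_upper_tail[of "- x" "- x'" v] assms
    by (metis Gauss_uminus diff_diff_eq2 add_diff_cancel_left' minus_minus neg_equal_iff_equal)
qed

section \<open>Concavity of the logarithmic summands, and the domain\<close>

definition gap :: "nat \<Rightarrow> (nat \<Rightarrow> 'n) \<Rightarrow> (nat \<Rightarrow> real) \<Rightarrow> nat \<Rightarrow> real ^ 'n \<Rightarrow> real" where
  "gap m e a i x =
    F (ext_coord m e x (i + 1) / ereal (a i)) - F (ext_coord m e x i / ereal (a i))"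

text \<open>Division by a positive \<open>a i\<close> keeps infinite ends infinite, so the
  conventions for \<open>F\<close> supply the values 0 and 1 and only real arguments remain.\<close>

lemma gap_eq:
  assumes "a i > 0" "i \<le> m"
  shows "gap m e a i x =
    (if i < m then Gauss (x $ e (i + 1) / a i) else 1) - (if i = 0 then 0 else Gauss (x $ e i / a i))"
  using assms by (cases "i = 0") (auto simp: gap_def ext_coord_def Gauss_def F_def)

lemma ln_gap_strict_concave:
  assumes m: "m \<ge> 1" and x: "x \<in> \<Omega> m e" and y: "y \<in> \<Omega> m e" and v: "0 < v" "v < 1"
    and a: "a i > 0" and i: "i \<le> m"
    and ne: "i \<ge> 1 \<and> x $ e i \<noteq> y $ e i \<or> i < m \<and> x $ e (i + 1) \<noteq> y $ e (i + 1)"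
  shows "(1 - v) * ln (gap m e a i x) + v * ln (gap m e a i y)
    < ln (gap m e a i ((1 - v) *\<^sub>R x + v *\<^sub>R y))"
proof -
  have div: "((1 - v) *\<^sub>R x + v *\<^sub>R y) $ j / b = (1 - v) * (x $ j / b) + v * (y $ j / b)" for j b
    by (simp add: add_divide_distrib)
  \<comment> \<open>Since \<open>m\<close> is at least 1, every gap has a finite end: the first is a
    lower tail, the last an upper tail, all others are bounded intervals.\<close>
  consider "i = 0" | "i = m" "i \<noteq> 0" | "1 \<le> i" "i < m"
    using i by linarith
  thus ?thesis
  proof cases
    case 1
    thus ?thesis
      using strict_concave_ln_Gauss_lower_tail[of "x $ e 1 / a i" "y $ e 1 / a i" v] ne a m v
      by (simp add: gap_eq div del: vector_add_component vector_scaleR_component)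
  next
    case 2
    thus ?thesis
      using strict_concave_ln_Gauss_upper_tail[of "x $ e i / a i" "y $ e i / a i" v] ne a m v
      by (simp add: gap_eq div del: vector_add_component vector_scaleR_component)
  next
    case 3
    hence "x $ e i / a i < x $ e (i + 1) / a i" "y $ e i / a i < y $ e (i + 1) / a i"
      using x y a by (auto simp: \<Omega>_def divide_strict_right_mono)
    from strict_concave_ln_Gauss_gap[OF this _ v] show ?thesis
      using 3 ne a
      by (simp add: gap_eq div del: vector_add_component vector_scaleR_component)
  qed
qed

text \<open>If no finite end of the gap differs between \<open>x\<close> and \<open>y\<close>, the
  gap has the same value at all three points and equality holds; otherwise the strict version
  applies.\<close>

lemma ln_gap_concave:
  assumes "m \<ge> 1" "x \<in> \<Omega> m e" "y \<in> \<Omega> m e" "0 < v" "v < 1" and a: "a i > 0" and i: "i \<le> m"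
  shows "(1 - v) * ln (gap m e a i x) + v * ln (gap m e a i y)
    \<le> ln (gap m e a i ((1 - v) *\<^sub>R x + v *\<^sub>R y))"
proof (cases "i \<ge> 1 \<and> x $ e i \<noteq> y $ e i \<or> i < m \<and> x $ e (i + 1) \<noteq> y $ e (i + 1)")
  case True
  thus ?thesis using ln_gap_strict_concave[where a = a and i = i, OF assms] by (intro less_imp_le)
next
  case False
  have "(1 - v) * r + v * r = r" for r
    by (simp add: algebra_simps)
  moreover have "gap m e a i x = gap m e a i y"
    "gap m e a i ((1 - v) *\<^sub>R x + v *\<^sub>R y) = gap m e a i y"
    using False i calculation by (auto simp: gap_eq[where a = a and i = i, OF a i])
  ultimately show ?thesis by simp
qed

lemma open_\<Omega>: "open (\<Omega> m (e :: nat \<Rightarrow> 'n::finite))"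
proof -
  have "\<Omega> m e = (\<Inter>i\<in>{1..<m}. {x. x $ e i < x $ e (i + 1)})"
    by (auto simp: \<Omega>_def)
  also have "open \<dots>"
    by (intro open_INT ballI open_Collect_less continuous_intros) auto
  finally show ?thesis .
qed

lemma convex_\<Omega>: "convex (\<Omega> m e)"
  by (auto simp: convex_def \<Omega>_def intro!: convex_combination_less)

theorem theorem1p3:
  fixes m :: nat
    and e :: "nat \<Rightarrow> 'n::finite"
    and u a k d :: "nat \<Rightarrow> real"
  assumes "m \<ge> 1"
    and "bij_betw e {1..m} (UNIV :: 'n set)"
    and "\<forall>i\<in>{0..m}. u i < u (i + 1)"
    and "\<forall>i\<in>{0..m}. a i > 0"
    and "\<forall>i\<in>{0..m}. k i > 0"
    and "\<forall>i\<in>{1..m}. d i \<ge> 0"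
  shows "open (\<Omega> m e) \<and> convex (\<Omega> m e) \<and> strictly_convex_on (\<Omega> m e) (E m e u a k d)"
proof -
  define w where "w i = k i * (u (i + 1) - u i)" for i
  have w: "w i > 0" if "i \<in> {0..m}" for i
    using that assms(3,5) by (simp add: w_def)
  have "E m e u a k d ((1 - v) *\<^sub>R x + v *\<^sub>R y) < (1 - v) * E m e u a k d x + v * E m e u a k d y"
    if x: "x \<in> \<Omega> m e" and y: "y \<in> \<Omega> m e" and "x \<noteq> y" and v: "0 < v" "v < 1" for x y v
  proof -
    let ?z = "(1 - v) *\<^sub>R x + v *\<^sub>R y"
    define L where "L z = (\<Sum>i=0..m. w i * ln (gap m e a i z))" for z
    define Q where "Q z = (\<Sum>i=1..m. d i * (z $ e i)^2 / 4)" for z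
    have E: "E m e u a k d z = - L z + Q z" for z
      by (simp add: E_def L_def Q_def w_def gap_def)
    obtain n where "x $ n \<noteq> y $ n"
      using \<open>x \<noteq> y\<close> by (auto simp: vec_eq_iff)
    then obtain j where j: "j \<in> {1..m}" "x $ e j \<noteq> y $ e j"
      using bij_betw_imp_surj_on[OF assms(2)] by (metis UNIV_I imageE)
    have "(1 - v) * L x + v * L y
        = (\<Sum>i=0..m. w i * ((1 - v) * ln (gap m e a i x) + v * ln (gap m e a i y)))"
      by (simp add: L_def sum_distrib_left flip: sum.distrib) (simp add: algebra_simps)
    also have "\<dots> < L ?z"
      unfolding L_def
    proof (rule sum_strict_mono_ex1)
      show "\<forall>i\<in>{0..m}. w i * ((1 - v) * ln (gap m e a i x) + v * ln (gap m e a i y))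
          \<le> w i * ln (gap m e a i ?z)"
        using assms(1,4) x y v
        by (intro ballI mult_left_mono ln_gap_concave less_imp_le[OF w]) auto
      \<comment> \<open>Coordinate \<open>j\<close>, in which the points differ, is the lower end of
        gap \<open>j\<close>, so this summand is strict.\<close>
      show "\<exists>i\<in>{0..m}. w i * ((1 - v) * ln (gap m e a i x) + v * ln (gap m e a i y))
          < w i * ln (gap m e a i ?z)"
        using assms(1,4) x y v j
        by (intro bexI[of _ j] mult_strict_left_mono ln_gap_strict_concave w) auto
    qed simp
    finally have L: "(1 - v) * L x + v * L y < L ?z" .
    \<comment> \<open>Weak convexity of the square suffices here, the strict inequality having come
      from \<open>L\<close>.\<close>
    have sq: "((1 - v) * p + v * q)\<^sup>2 \<le> (1 - v) * p\<^sup>2 + v * q\<^sup>2" for p q :: real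
    proof -
      have "(1 - v) * p\<^sup>2 + v * q\<^sup>2 - ((1 - v) * p + v * q)\<^sup>2 = v * (1 - v) * (p - q)\<^sup>2"
        by (simp add: power2_eq_square algebra_simps)
      also have "\<dots> \<ge> 0" using v by simp
      finally show ?thesis by simp
    qed
    have "Q ?z \<le> (\<Sum>i=1..m. d i / 4 * ((1 - v) * (x $ e i)\<^sup>2 + v * (y $ e i)\<^sup>2))"
      unfolding Q_def
    proof (rule sum_mono)
      fix i assume "i \<in> {1..m}"
      thus "d i * (?z $ e i)\<^sup>2 / 4 \<le> d i / 4 * ((1 - v) * (x $ e i)\<^sup>2 + v * (y $ e i)\<^sup>2)"
        using mult_left_mono[OF sq, of "d i / 4"] assms(6) by simp
    qed
    also have "\<dots> = (1 - v) * Q x + v * Q y"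
      by (simp add: Q_def sum_distrib_left flip: sum.distrib)
         (intro sum.cong, auto simp: field_simps)
    finally have "Q ?z \<le> (1 - v) * Q x + v * Q y" .
    with L show ?thesis
      unfolding E by (simp add: algebra_simps)
  qed
  note main = this
  have "strictly_convex_on (\<Omega> m e) (E m e u a k d)"
    unfolding strictly_convex_on_def
  proof (intro conjI convex_\<Omega> ballI allI impI)
    fix x y and s t :: real
    assume "x \<in> \<Omega> m e" "y \<in> \<Omega> m e" "0 < s" "0 < t" "x \<noteq> y" "s + t = 1"
    moreover from \<open>s + t = 1\<close> have "s = 1 - t" by simp
    ultimately show "E m e u a k d (s *\<^sub>R x + t *\<^sub>R y) < s * E m e u a k d x + t * E m e u a k d y"
      using main[of x y t] by simp
  qed
  thus ?thesis
    using open_\<Omega> convex_\<Omega> by blast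
qed

end
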